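(* Let $\mathbf{h}$ be a feasible path flow vector and let $\mathcal{K}(\mathbf{h})=\mathcal{H}'_{\mathbf p}(\mathbf h)\,\mathcal{P}'(\mathbf c)\,\mathcal{C}'(\mathbf h)\in\mathbb{R}^{n\times n}$ (with $\mathbf c=\mathcal{C}(\mathbf h)$) be the reduced Jacobian of the logit mapping. Then: 1. All eigenvalues of $\mathcal{K}(\mathbf{h})$ are real and non-positive. 2. The maximum eigenvalue of $\mathcal{K}(\mathbf{h})$ is zero. 3. The minimum eigenvalue $\lambda_{\min}$ of $\mathcal{K}(\mathbf{h})$ satisfies $\lambda_{\min}\ \ge\ -\theta\,\bigl(\max_{OD} d_{OD}\bigr)\,\|\mathcal{C}'(\mathbf{h})\|$.
   Context: Network setting. There is a finite set $\mathbb{L}$ of links and a finite nonempty set of origin-destination (OD) pairs. Each OD pair has a demand $d_{OD}\ge 0$ and a fixed finite nonempty set $\mathbb{P}_{OD}$ of acyclic paths; $\mathbb{P}$ is the disjoint union of the $\mathbb{P}_{OD}$, $n=|\mathbb{P}|$, and $OD(i)$ is the OD pair of path $i$. $\mathbf{D}\in\{0,1\}^{|\mathbb{L}|\times n}$ is the link-path incidence matrix ($D_{li}=1$ iff link $l$ is on path $i$). A vector $\mathbf{h}\in\mathbb{R}^n$ is a feasible path flow vector if $h_i\ge 0$ for all $i$ and $\sum_{i\in\mathbb{P}_{OD}}h_i=d_{OD}$ for every OD pair. Costs. The cost of link $l$ depends only on its own flow $a_l$ via $\tau_l:[0,\infty)\to[0,\infty)$, which is twice continuously differentiable and monotone non-decreasing,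 with $\tau_l'$ Lipschitz on the bounded set of link flows arising from feasible path flows. Link flows are $\mathbf a=\mathbf D\mathbf h$, path costs are $\mathcal{C}(\mathbf h)=\mathbf{D}^T\mathcal{T}(\mathbf{D}\mathbf{h})$ with $\mathcal{T}_l(\mathbf a)=\tau_l(a_l)$, and the Jacobian is $\mathcal{C}'(\mathbf h)=\mathbf D^T\operatorname{diag}(\tau_l'(a_l))\mathbf D$. Logit model. $\theta>0$ is a fixed parameter. For a path cost vector $\mathbf c$, $\mathcal{P}(\mathbf c)_i=\exp(-\theta c_i)/\sum_{i'\in\mathbb{P}_{OD(i)}}\exp(-\theta c_{i'})$. Put $\mathcal{H}(\mathbf h,\mathbf p)_i=\bigl(\sum_{i'\in\mathbb{P}_{OD(i)}}h_{i'}\bigr)p_i$. $\mathcal{P}'(\mathbf c)$ is the Jacobian of $\mathcal{P}$, and $\mathcal{H}'_{\mathbf p}(\mathbf h)$ is the Jacobian of $\mathcal{H}$ in $\mathbf p$ with $\mathbf h$ fixed (for feasible $\mathbf h$, the diagonal matrix with entries $d_{OD(i)}$). $\|\cdot\|$ is the $\ell_2$ norm and its induced matrix (spectral) norm. *)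

theory Defs
  imports "HOL-Analysis.Analysis" "Graph_Theory.Digraph" "Graph_Theory.Arc_Walk"
begin

section \<open>Eigenvalues of a real square matrix\<close>

text \<open>Eigenvalues are complex numbers with a nonzero complex eigenvector, so that their being real
  is a genuine assertion.\<close>

definition eigenvalues :: "real ^ 'n ^ 'n \<Rightarrow> complex set" where
  "eigenvalues A =
     {z. \<exists>v :: complex ^ 'n. v \<noteq> 0 \<and> map_matrix complex_of_real A *v v = z *s v}"

definition real_eigenvalues :: "real ^ 'n ^ 'n \<Rightarrow> real set" where
  "real_eigenvalues A = {x. complex_of_real x \<in> eigenvalues A}"

lemma eigenvectors_independent:
  fixes M :: "complex ^ 'n ^ 'n" and v :: "complex \<Rightarrow> complex ^ 'n"
  assumes "finite S"
    and "\<And>z. z \<in> S \<Longrightarrow> v z \<noteq> 0 \<and> M *v v z = z *s v z"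
    and "(\<Sum>z\<in>S. c z *s v z) = 0"
  shows "\<forall>z\<in>S. c z = 0"
  using assms
proof (induction S arbitrary: c rule: finite_induct)
  case empty
  then show ?case by simp
next
  case (insert w S)
  let ?s = "\<lambda>c. \<Sum>z\<in>S. c z *s v z"
  have e1: "c w *s v w + ?s c = 0"
    using insert.prems(2) insert.hyps by simp
  have "M *v ?s c = (\<Sum>z\<in>S. c z *s (M *v v z))"
    by (simp add: matrix_vector_mult_scaleR vec.linear_sum[OF matrix_vector_mul_linear_gen]
        vector_scalar_commute)
  also have "\<dots> = (\<Sum>z\<in>S. (c z * z) *s v z)"
    using insert.prems(1) by (intro sum.cong) auto
  finally have m: "M *v ?s c = (\<Sum>z\<in>S. (c z * z) *s v z)" .
  have "M *v (c w *s v w) = (c w * w) *s v w"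
    using insert.prems(1)[of w] by (simp add: vector_scalar_commute)
  then have e2: "(c w * w) *s v w + (\<Sum>z\<in>S. (c z * z) *s v z) = 0"
    using arg_cong[OF e1, of "\<lambda>x. M *v x"] m by (simp add: matrix_vector_right_distrib)
  have e3: "(c w * w) *s v w + (\<Sum>z\<in>S. (c z * w) *s v z) = 0"
    using arg_cong[OF e1, of "\<lambda>x. w *s x"]
    by (simp add: vec.scale_right_distrib vec.scale_sum_right mult.commute)
  have "(\<Sum>z\<in>S. (c z * (z - w)) *s v z) = 0"
    using e2 e3 by (simp add: right_diff_distrib vec.scale_left_diff_distrib sum_subtractf)
      (metis add_left_cancel)
  then have "\<forall>z\<in>S. c z * (z - w) = 0"
    by (intro insert.IH) (use insert.prems(1) in auto)
  then have z: "\<forall>z\<in>S. c z = 0"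
    using insert.hyps(2) by auto
  then have "c w *s v w = 0"
    using e1 by simp
  then have "c w = 0"
    using insert.prems(1)[of w] by simp
  with z show ?case by simp
qed

lemma finite_eigenvalues: "finite (eigenvalues (A :: real ^ 'n ^ 'n))"
proof -
  let ?M = "map_matrix complex_of_real A"
  have "\<forall>z\<in>eigenvalues A. \<exists>v. v \<noteq> 0 \<and> ?M *v v = z *s v"
    unfolding eigenvalues_def by blast
  from bchoice[OF this] obtain v
    where v: "\<And>z. z \<in> eigenvalues A \<Longrightarrow> v z \<noteq> 0 \<and> ?M *v v z = z *s v z"
    by blast
  have bound: "card S \<le> CARD('n)" if S: "S \<subseteq> eigenvalues A" "finite S" for S
  proof -
    have ind: "\<forall>z\<in>S. c z = 0" if "(\<Sum>z\<in>S. c z *s v z) = 0" for c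
      using eigenvectors_independent[OF S(2) _ that] v S(1) by blast
    have inj: "inj_on v S"
    proof (rule inj_onI, rule ccontr)
      fix x y assume xy: "x \<in> S" "y \<in> S" "v x = v y" "x \<noteq> y"
      let ?c = "\<lambda>z. if z = x then 1 else if z = y then - 1 else (0 :: complex)"
      have "(\<Sum>z\<in>S. ?c z *s v z) = (\<Sum>z\<in>{x, y}. ?c z *s v z)"
        using xy S(2) by (intro sum.mono_neutral_right) auto
      also have "\<dots> = 0" using xy by simp
      finally have "\<forall>z\<in>S. ?c z = 0" by (rule ind)
      then show False using xy(1) by auto
    qed
    have "vec.independent (v ` S)"
    proof (rule vec.independent_if_scalars_zero)
      show "finite (v ` S)" using S by simp
      fix f x assume f: "(\<Sum>x\<in>v ` S. f x *s x) = 0" and x: "x \<in> v ` S"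
      then have "(\<Sum>z\<in>S. f (v z) *s v z) = 0"
        using inj by (simp add: sum.reindex)
      from ind[OF this] x show "f x = 0" by blast
    qed
    then have "card (v ` S) \<le> CARD('n)"
      using vec.independent_bound_general[of "v ` S"] vec.dim_subset[OF subset_UNIV, of "v ` S"]
      by (auto simp: vec_dim_card card_cart_basis)
    then show ?thesis using S inj by (simp add: card_image)
  qed
  have "finite (eigenvalues A) \<and> card (eigenvalues A) \<le> CARD('n)"
    by (rule finite_if_finite_subsets_card_bdd) (use bound in auto)
  then show ?thesis ..
qed

lemma finite_real_eigenvalues: "finite (real_eigenvalues A)"
proof -
  have "real_eigenvalues A = complex_of_real -` eigenvalues A"
    by (auto simp: real_eigenvalues_def)
  then show ?thesis
    using finite_vimageI[OF finite_eigenvalues, of complex_of_real] by (simp add: inj_def)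
qed

section \<open>Flows and costs\<close>

text \<open>The type \<open>'p\<close> indexes the disjoint union of the path sets; path \<open>i\<close> is the list of links
  \<open>links_of i\<close> and serves the OD pair \<open>od i\<close>, so the path set of \<open>w\<close> is \<open>{i. od i = w}\<close>.\<close>

definition incidence :: "('p::finite \<Rightarrow> 'l list) \<Rightarrow> real ^ 'p ^ 'l::finite" where
  "incidence links_of = (\<chi> l i. of_bool (l \<in> set (links_of i)))"

definition feasible :: "('p::finite \<Rightarrow> 'w) \<Rightarrow> ('w \<Rightarrow> real) \<Rightarrow> real ^ 'p \<Rightarrow> bool" where
  "feasible od d h \<longleftrightarrow> (\<forall>i. 0 \<le> h $ i) \<and> (\<forall>w. (\<Sum>i | od i = w. h $ i) = d w)"

text \<open>Link cost functions are defined on \<open>[0, \<infinity>)\<close>; at \<open>0\<close> this is the one-sided derivative.\<close>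

definition link_deriv :: "(real \<Rightarrow> real) \<Rightarrow> real \<Rightarrow> real" where
  "link_deriv f x = vector_derivative f (at x within {0..})"

definition path_cost :: "('p::finite \<Rightarrow> 'l::finite list) \<Rightarrow> ('l \<Rightarrow> real \<Rightarrow> real) \<Rightarrow> real ^ 'p \<Rightarrow> real ^ 'p"
  where "path_cost links_of \<tau> h =
    transpose (incidence links_of) *v (\<chi> l. \<tau> l ((incidence links_of *v h) $ l))"

text \<open>Since link costs are only given at nonnegative flows, the Jacobian of the path cost is taken
  within the nonnegative orthant (cf. \<open>path_cost_jacobian_eq\<close> below).\<close>

definition path_cost_jacobian ::
    "('p::finite \<Rightarrow> 'l::finite list) \<Rightarrow> ('l \<Rightarrow> real \<Rightarrow> real) \<Rightarrow> real ^ 'p \<Rightarrow> real ^ 'p ^ 'p" where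
  "path_cost_jacobian links_of \<tau> h = jacobian (path_cost links_of \<tau>) (at h within {h. \<forall>i. 0 \<le> h $ i})"

section \<open>The logit mapping\<close>

definition logit :: "real \<Rightarrow> ('p::finite \<Rightarrow> 'w) \<Rightarrow> real ^ 'p \<Rightarrow> real ^ 'p" where
  "logit \<theta> od c = (\<chi> i. exp (- \<theta> * c $ i) / (\<Sum>j | od j = od i. exp (- \<theta> * c $ j)))"

definition assigned_flow :: "('p::finite \<Rightarrow> 'w) \<Rightarrow> real ^ 'p \<Rightarrow> real ^ 'p \<Rightarrow> real ^ 'p" where
  "assigned_flow od h p = (\<chi> i. (\<Sum>j | od j = od i. h $ j) * p $ i)"

definition reduced_jacobian ::
    "real \<Rightarrow> ('p::finite \<Rightarrow> 'w) \<Rightarrow> ('p \<Rightarrow> 'l::finite list) \<Rightarrow> ('l \<Rightarrow> real \<Rightarrow> real)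
      \<Rightarrow> real ^ 'p \<Rightarrow> real ^ 'p ^ 'p" where
  "reduced_jacobian \<theta> od links_of \<tau> h =
    (let c = path_cost links_of \<tau> h
     in jacobian (assigned_flow od h) (at (logit \<theta> od c))
        ** jacobian (logit \<theta> od) (at c)
        ** path_cost_jacobian links_of \<tau> h)"

section \<open>The standing assumptions\<close>

locale logit_network = wf_digraph G
  for G :: "('v, 'l::finite) pre_digraph" +
  fixes od_pair :: "'w::finite \<Rightarrow> 'v \<times> 'v"
    and d :: "'w \<Rightarrow> real"
    and od :: "'p::finite \<Rightarrow> 'w"
    and links_of :: "'p \<Rightarrow> 'l list"
    and \<tau> :: "'l \<Rightarrow> real \<Rightarrow> real"
    and \<theta> :: real
  assumes links: "arcs G = UNIV"
    and od_pairs_distinct: "inj od_pair"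
    and demand_nonneg: "0 \<le> d w"
    and path_sets_nonempty: "surj od"
    and paths_distinct: "inj (\<lambda>i. (od i, links_of i))"
    and path_acyclic: "pre_digraph.apath G (fst (od_pair (od i))) (links_of i) (snd (od_pair (od i)))"
    and cost_nonneg: "0 \<le> x \<Longrightarrow> 0 \<le> \<tau> l x"
    and cost_mono: "mono_on {0..} (\<tau> l)"
    and cost_differentiable: "\<tau> l differentiable_on {0..}"
    and cost_twice_differentiable: "link_deriv (\<tau> l) differentiable_on {0..}"
    and cost_C2: "continuous_on {0..} (link_deriv (link_deriv (\<tau> l)))"
    and cost_deriv_lipschitz:
      "\<exists>B. B-lipschitz_on {(incidence links_of *v h) $ l | h. feasible od d h} (link_deriv (\<tau> l))"
    and theta_pos: "0 < \<theta>"

section \<open>The closed forms of the Jacobians\<close>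

lemma jacobian_within_orthant:
  fixes f :: "real ^ 'n \<Rightarrow> real ^ 'm"
  assumes "(f has_derivative (\<lambda>x. M *v x)) (at h within {h. \<forall>i. 0 \<le> h $ i})"
    and "\<And>i. 0 \<le> h $ i"
  shows "jacobian f (at h within {h. \<forall>i. 0 \<le> h $ i}) = M"
proof -
  let ?S = "{h :: real ^ 'n. \<forall>i. 0 \<le> h $ i}"
  have "(f has_derivative frechet_derivative f (at h within ?S)) (at h within ?S)"
    using assms(1) differentiable_def frechet_derivative_works by blast
  then have "frechet_derivative f (at h within ?S) = (\<lambda>x. M *v x)"
  proof (rule frechet_derivative_unique_within[OF _ assms(1)])
    fix b :: "real ^ 'n" and e :: real assume b: "b \<in> Basis" and e: "0 < e"
    have "h + (e / 2) *\<^sub>R b \<in> ?S"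
      using b e assms(2) by (auto simp: Basis_vec_def axis_def)
    then show "\<exists>d. 0 < \<bar>d\<bar> \<and> \<bar>d\<bar> < e \<and> h + d *\<^sub>R b \<in> ?S"
      using e by (intro exI[of _ "e / 2"]) auto
  qed
  then show ?thesis by (simp add: jacobian_def)
qed

context logit_network
begin

lemma path_cost_jacobian_eq:
  assumes h: "\<And>i. 0 \<le> h $ i"
  shows "path_cost_jacobian links_of \<tau> h =
    transpose (incidence links_of)
      ** (\<chi> l m. if l = m then link_deriv (\<tau> l) ((incidence links_of *v h) $ l) else 0)
      ** incidence links_of"
proof -
  let ?D = "incidence links_of" and ?S = "{h :: real ^ 'p. \<forall>i. 0 \<le> h $ i}"
  let ?t = "\<lambda>l. link_deriv (\<tau> l) ((?D *v h) $ l)"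
  have nn: "0 \<le> (?D *v x) $ l" if "x \<in> ?S" for x l
    using that by (auto simp: matrix_vector_mult_def incidence_def intro!: sum_nonneg)
  have t: "(\<tau> l has_derivative (\<lambda>y. y * ?t l)) (at ((?D *v h) $ l) within {0..})" for l
  proof -
    have "\<tau> l differentiable (at ((?D *v h) $ l) within {0..})"
      using cost_differentiable[of l] nn[of h l] h by (auto simp: differentiable_on_def)
    then show ?thesis
      unfolding link_deriv_def by (simp add: vector_derivative_works has_vector_derivative_def)
  qed
  have c: "((\<lambda>x. (?D *v x) $ l) has_derivative (\<lambda>x. (?D *v x) $ l)) (at h within ?S)" for l
    by (intro bounded_linear_imp_has_derivative linear_conv_bounded_linear[THEN iffD1])
      (auto intro!: linearI simp: matrix_vector_right_distrib matrix_vector_mult_scaleR)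
  have "((\<lambda>x. \<tau> l ((?D *v x) $ l)) has_derivative (\<lambda>x. (?D *v x) $ l * ?t l)) (at h within ?S)" for l
  proof -
    have "((\<lambda>x. \<tau> l ((?D *v x) $ l)) has_derivative (\<lambda>y. y * ?t l) \<circ> (\<lambda>x. (?D *v x) $ l))
        (at h within ?S)"
      using diff_chain_within[OF c has_derivative_subset[OF t]] nn
      by (fastforce simp: o_def)
    then show ?thesis by (simp add: o_def)
  qed
  then have v: "((\<lambda>x. \<chi> l. \<tau> l ((?D *v x) $ l)) has_derivative (\<lambda>x. \<chi> l. (?D *v x) $ l * ?t l))
      (at h within ?S)"
    by (subst has_derivative_componentwise_within) (auto simp: Basis_vec_def inner_axis)
  have "(path_cost links_of \<tau> has_derivative (\<lambda>x. transpose ?D *v (\<chi> l. (?D *v x) $ l * ?t l)))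
      (at h within ?S)"
    using bounded_linear.has_derivative[OF matrix_vector_mul_bounded_linear[of "transpose ?D"] v]
    unfolding path_cost_def[abs_def] .
  moreover have "transpose ?D *v (\<chi> l. (?D *v x) $ l * ?t l) =
      (transpose ?D ** (\<chi> l m. if l = m then ?t l else 0) ** ?D) *v x" for x
  proof -
    have "(\<chi> l m. if l = m then ?t l else 0) *v y = (\<chi> l. y $ l * ?t l)" for y
      by (simp add: matrix_vector_mult_def vec_eq_iff if_distrib[of "\<lambda>x. x * _"] mult.commute[of _ "link_deriv _ _"]
          cong: if_cong)
    then show ?thesis
      by (simp only: matrix_vector_mul_assoc[symmetric])
  qed
  ultimately show ?thesis
    unfolding path_cost_jacobian_def using h by (intro jacobian_within_orthant) auto
qed

lemma assigned_flow_jacobian_eq: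
  assumes "feasible od d h"
  shows "jacobian (assigned_flow od h) (at p) = (\<chi> i j. if i = j then d (od i) else 0)"
proof -
  let ?M = "(\<chi> i j. if i = j then d (od i) else 0) :: real ^ 'p ^ 'p"
  have "assigned_flow od h = (\<lambda>q. ?M *v q)"
    using assms
    by (simp add: fun_eq_iff vec_eq_iff assigned_flow_def feasible_def matrix_vector_mult_def
        if_distrib[of "\<lambda>x. x * _"] cong: if_cong)
  then have "(assigned_flow od h has_derivative (\<lambda>q. ?M *v q)) (at p)"
    by (simp add: bounded_linear_imp_has_derivative matrix_vector_mul_bounded_linear)
  from frechet_derivative_at[OF this, symmetric] show ?thesis
    by (simp only: jacobian_def matrix_of_matrix_vector_mul)
qed

end

end

theory Submission
  imports Defs
begin

text \<open>The product of the first two Jacobians is \<open>- S\<close>, where \<open>S\<close> is symmetric and block diagonal over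
  OD pairs: on a block, its quadratic form is \<open>\<theta> d\<close> times the variance under the logit
  probabilities, so \<open>0 \<le> S \<le> \<theta> (max d) I\<close>. The cost Jacobian \<open>J\<close> is symmetric and positive
  semidefinite because link costs are monotone. If \<open>- S J v = z v\<close>, pairing with \<open>J v\<close> gives
  \<open>z \<langle>v, J v\<rangle> = - \<langle>J v, S J v\<rangle>\<close>; both forms are real and nonnegative, and \<open>|J v|\<^sup>2 \<le> \<parallel>J\<parallel> \<langle>v, J v\<rangle>\<close>.
  Finally \<open>S\<close> annihilates constant vectors, so \<open>S J\<close> is singular.\<close>

section \<open>Products of positive semidefinite matrices\<close>

lemma inner_symmetric_matrix:
  fixes A :: "real ^ 'n ^ 'n"
  assumes "transpose A = A"
  shows "(A *v x) \<bullet> y = x \<bullet> (A *v y)"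
  using dot_lmul_matrix[of x A y] assms by (metis transpose_matrix_vector)

lemma uminus_matrix_mult: "(- A) *v x = - (A *v x)" for A :: "real ^ 'n ^ 'm"
  by (simp add: matrix_vector_mult_def vec_eq_iff sum_negf)

text \<open>From \<open>J \<le> N I\<close>, with \<open>N\<close> the operator norm, one expects
  \<open>J^2 \<le> N J\<close>. No square root of \<open>J\<close> is needed: positivity of the form
  of \<open>J\<close> at \<open>N x - J x\<close>, together with Cauchy-Schwarz at
  \<open>J x\<close>, gives the inequality multiplied by \<open>N\<close>.\<close>

lemma psd_norm_square_le:
  fixes J :: "real ^ 'n ^ 'n"
  assumes sym: "transpose J = J" and psd: "\<And>x. 0 \<le> x \<bullet> (J *v x)"
  shows "(J *v x) \<bullet> (J *v x) \<le> onorm (\<lambda>x. J *v x) * (x \<bullet> (J *v x))"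
proof -
  let ?N = "onorm (\<lambda>x. J *v x)" and ?y = "J *v x"
  have bl: "bounded_linear (\<lambda>x. J *v x)" by (rule matrix_vector_mul_bounded_linear)
  have N0: "0 \<le> ?N" by (rule onorm_pos_le[OF bl])
  have yy: "?y \<bullet> (J *v ?y) \<le> ?N * (?y \<bullet> ?y)"
  proof -
    have "?y \<bullet> (J *v ?y) \<le> norm ?y * norm (J *v ?y)" by (rule norm_cauchy_schwarz)
    also have "\<dots> \<le> norm ?y * (?N * norm ?y)"
      by (intro mult_left_mono onorm[OF bl]) auto
    finally show ?thesis by (simp add: power2_norm_eq_inner[symmetric] power2_eq_square mult_ac)
  qed
  show ?thesis
  proof (cases "?N = 0")
    case True
    then show ?thesis using onorm[OF bl, of x] by simp
  next
    case False
    with N0 have Np: "0 < ?N" by simp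
    have "0 \<le> (?N *\<^sub>R x - ?y) \<bullet> (J *v (?N *\<^sub>R x - ?y))" by (rule psd)
    also have "\<dots> = ?N * (?N * (x \<bullet> ?y)) - 2 * ?N * (?y \<bullet> ?y) + ?y \<bullet> (J *v ?y)"
      using inner_symmetric_matrix[OF sym, of x ?y]
      by (simp add: matrix_vector_mult_diff_distrib matrix_vector_mult_scaleR inner_diff_left
          inner_diff_right algebra_simps)
    also have "\<dots> \<le> ?N * (?N * (x \<bullet> ?y) - ?y \<bullet> ?y)"
      using yy by (simp add: algebra_simps)
    finally show ?thesis using Np by (simp add: zero_le_mult_iff)
  qed
qed

text \<open>The product \<open>S ** J\<close> is not symmetric in general, so complex eigenvectors
  have to be allowed. Splitting \<open>v = x + iy\<close> turns the pairing with \<open>J v\<close>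
  into two real identities, one for each of \<open>Re z\<close> and \<open>Im z\<close>.\<close>

lemma eigenvalues_neg_psd_product:
  fixes S J :: "real ^ 'n ^ 'n"
  assumes symS: "transpose S = S" and psdS: "\<And>x. 0 \<le> x \<bullet> (S *v x)"
    and le: "\<And>x. x \<bullet> (S *v x) \<le> s * (x \<bullet> x)" and s: "0 \<le> s"
    and symJ: "transpose J = J" and psdJ: "\<And>x. 0 \<le> x \<bullet> (J *v x)"
    and z: "z \<in> eigenvalues (- (S ** J))"
  shows "z \<in> \<real>" "Re z \<le> 0" "- s * onorm (\<lambda>x. J *v x) \<le> Re z"
proof -
  let ?N = "onorm (\<lambda>x. J *v x)"
  have N0: "0 \<le> ?N" by (rule onorm_pos_le[OF matrix_vector_mul_bounded_linear])
  obtain v where v0: "v \<noteq> 0" and v: "map_matrix complex_of_real (- (S ** J)) *v v = z *s v"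
    using z by (auto simp: eigenvalues_def)
  define x where "x = (\<chi> i. Re (v $ i))"
  define y where "y = (\<chi> i. Im (v $ i))"
  define a where "a = Re z"
  define b where "b = Im z"
  have comp: "(\<Sum>j\<in>UNIV. complex_of_real ((- (S ** J)) $ i $ j) * v $ j) = z * v $ i" for i
    using arg_cong[OF v, of "\<lambda>u. u $ i"] by (simp add: matrix_vector_mult_def map_matrix_def)
  have "- (S ** J) *v x = a *\<^sub>R x - b *\<^sub>R y"
    using arg_cong[OF comp, of Re]
    by (simp add: vec_eq_iff matrix_vector_mult_def x_def y_def a_def b_def)
  then have ex: "- (S *v (J *v x)) = a *\<^sub>R x - b *\<^sub>R y"
    by (simp add: uminus_matrix_mult matrix_vector_mul_assoc)
  have "- (S ** J) *v y = a *\<^sub>R y + b *\<^sub>R x"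
    using arg_cong[OF comp, of Im]
    by (simp add: vec_eq_iff matrix_vector_mult_def x_def y_def a_def b_def)
  then have ey: "- (S *v (J *v y)) = a *\<^sub>R y + b *\<^sub>R x"
    by (simp add: uminus_matrix_mult matrix_vector_mul_assoc)
  \<comment> \<open>\<open>q\<close> and \<open>r\<close> are the Hermitian forms of
    \<open>J\<close> at \<open>v\<close> and of \<open>S\<close> at \<open>J v\<close>; the symmetry
    of \<open>J\<close> and \<open>S\<close> makes their imaginary parts vanish.\<close>
  define q where "q = x \<bullet> (J *v x) + y \<bullet> (J *v y)"
  define r where "r = (J *v x) \<bullet> (S *v (J *v x)) + (J *v y) \<bullet> (S *v (J *v y))"
  have xy: "(J *v x) \<bullet> y = (J *v y) \<bullet> x"
    using inner_symmetric_matrix[OF symJ, of x y] by (simp add: inner_commute)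
  have a: "a * q = - r"
    using arg_cong[OF ex, of "\<lambda>u. (J *v x) \<bullet> u"] arg_cong[OF ey, of "\<lambda>u. (J *v y) \<bullet> u"] xy
    by (simp add: q_def r_def inner_diff_right inner_add_right algebra_simps inner_commute)
  \<comment> \<open>Imaginary part of the pairing: subtracting the two cross equations cancels the
    \<open>S\<close> terms by symmetry of \<open>S\<close> and the \<open>a\<close> terms by
    \<open>xy\<close>.\<close>
  have b: "b * q = 0"
    using arg_cong[OF ex, of "\<lambda>u. (J *v y) \<bullet> u"] arg_cong[OF ey, of "\<lambda>u. (J *v x) \<bullet> u"] xy
      inner_symmetric_matrix[OF symS, of "J *v x" "J *v y"]
    by (simp add: q_def inner_diff_right inner_add_right algebra_simps inner_commute)
  have bound: "(J *v x) \<bullet> (J *v x) + (J *v y) \<bullet> (J *v y) \<le> ?N * q"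
    using psd_norm_square_le[OF symJ psdJ, of x] psd_norm_square_le[OF symJ psdJ, of y]
    by (simp add: q_def algebra_simps)
  have q0: "0 \<le> q" using psdJ by (simp add: q_def)
  have r0: "0 \<le> r" using psdS by (simp add: r_def)
  have rq: "r \<le> s * (?N * q)"
  proof -
    have "r \<le> s * ((J *v x) \<bullet> (J *v x) + (J *v y) \<bullet> (J *v y))"
      using le[of "J *v x"] le[of "J *v y"] by (simp add: r_def algebra_simps)
    also have "\<dots> \<le> s * (?N * q)" by (rule mult_left_mono[OF bound s])
    finally show ?thesis .
  qed
  have "b = 0 \<and> a \<le> 0 \<and> - s * ?N \<le> a"
  \<comment> \<open>If \<open>q = 0\<close>, nothing can be divided out, but \<open>bound\<close>
    then forces \<open>J v = 0\<close>, hence \<open>z = 0\<close>. Otherwise the claims follow on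
    dividing by \<open>q\<close>.\<close>
  proof (cases "q = 0")
    case True
    with bound have "(J *v x) \<bullet> (J *v x) + (J *v y) \<bullet> (J *v y) \<le> 0" by simp
    moreover have "0 \<le> (J *v x) \<bullet> (J *v x)" "0 \<le> (J *v y) \<bullet> (J *v y)" by simp_all
    ultimately have "J *v x = 0" "J *v y = 0"
      using inner_eq_zero_iff[of "J *v x"] inner_eq_zero_iff[of "J *v y"] by linarith+
    then have "map_matrix complex_of_real (- (S ** J)) *v v = 0"
      using ex ey
      by (simp only: v) (simp add: vec_eq_iff complex_eq_iff x_def y_def a_def b_def algebra_simps)
    with v v0 have "z = 0" by (simp add: vec.scale_eq_0_iff)
    then show ?thesis using s N0 by (simp add: a_def b_def)
  next
    case False
    with q0 have qp: "0 < q" by simp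
    have "a \<le> 0" using a r0 qp by (metis mult_less_0_iff mult_pos_pos neg_le_0_iff_le not_le)
    moreover have "0 \<le> (a + s * ?N) * q" using a rq by (simp add: algebra_simps)
    ultimately show ?thesis using b qp by (simp add: zero_le_mult_iff)
  qed
  then show "z \<in> \<real>" "Re z \<le> 0" "- s * ?N \<le> Re z"
    by (auto simp: a_def b_def complex_is_Real_iff)
qed

text \<open>A matrix and its transpose have the same determinant. The transposed form is the useful
  one: in \<open>S ** J\<close> the factor with the known null vector stands on the left.\<close>

lemma zero_in_real_eigenvalues:
  fixes A :: "real ^ 'n ^ 'n"
  assumes u: "u \<noteq> 0" "transpose A *v u = 0"
  shows "0 \<in> real_eigenvalues A"
proof -
  have "\<not> invertible (transpose A)"
    using u by (metis invertible_left_inverse matrix_left_invertible_ker)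
  then have "\<not> invertible A"
    by (simp add: invertible_det_nz det_transpose)
  then obtain x where x: "x \<noteq> 0" "A *v x = 0"
    by (metis invertible_left_inverse matrix_left_invertible_ker)
  let ?v = "(\<chi> i. complex_of_real (x $ i))"
  have "?v \<noteq> 0" using x by (auto simp: vec_eq_iff)
  moreover have "map_matrix complex_of_real A *v ?v = (\<chi> i. complex_of_real ((A *v x) $ i))"
    by (simp add: vec_eq_iff matrix_vector_mult_def map_matrix_def)
  ultimately show ?thesis
    using x(2) by (auto simp: real_eigenvalues_def eigenvalues_def vec_eq_iff intro!: exI[of _ ?v])
qed

section \<open>The logit Jacobian\<close>

lemma sum_logit:
  fixes od :: "'p::finite \<Rightarrow> 'w"
  shows "(\<Sum>j | od j = od i. logit \<theta> od c $ j) = 1"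
proof -
  have "0 < (\<Sum>j | od j = od i. exp (- \<theta> * c $ j))"
    by (rule sum_pos2[of _ i]) auto
  then show ?thesis
    by (simp add: logit_def sum_divide_distrib[symmetric])
qed

lemma logit_nonneg: "0 \<le> logit \<theta> od c $ i"
  by (simp add: logit_def sum_nonneg)

lemma logit_le_1: "logit \<theta> od c $ i \<le> 1"
  using member_le_sum[of i "{j. od j = od i}" "\<lambda>j. logit \<theta> od c $ j"]
  by (simp add: sum_logit logit_nonneg)

text \<open>On each OD block this is \<open>diag(p) - p p^T\<close>. For block-wise probabilities
  \<open>p\<close> it is the covariance matrix of the 0/1 indicator of the chosen path, with
  independent choices across OD pairs.\<close>

definition logit_covariance :: "('p::finite \<Rightarrow> 'w) \<Rightarrow> real ^ 'p \<Rightarrow> real ^ 'p ^ 'p" where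
  "logit_covariance od p =
    (\<chi> i j. (if i = j then p $ i else 0) - (if od j = od i then p $ i * p $ j else 0))"

lemma logit_covariance_mult_nth:
  "(logit_covariance od p *v x) $ i = p $ i * (x $ i - (\<Sum>j | od j = od i. p $ j * x $ j))"
proof -
  have "(logit_covariance od p *v x) $ i =
      (\<Sum>j\<in>UNIV. (if i = j then p $ i * x $ j else 0)
        - (if od j = od i then p $ i * (p $ j * x $ j) else 0))"
    by (auto simp: matrix_vector_mult_def logit_covariance_def algebra_simps intro!: sum.cong)
  also have "\<dots> = p $ i * x $ i - (\<Sum>j\<in>UNIV. if od j = od i then p $ i * (p $ j * x $ j) else 0)"
    by (simp add: sum_subtractf)
  also have "(\<Sum>j\<in>UNIV. if od j = od i then p $ i * (p $ j * x $ j) else 0) =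
      p $ i * (\<Sum>j | od j = od i. p $ j * x $ j)"
    by (simp add: sum_distrib_left sum.If_cases)
  finally show ?thesis by (simp add: algebra_simps)
qed

text \<open>The quotient rule, applied to each component, with the block normaliser as
  denominator.\<close>

lemma logit_jacobian_eq:
  fixes od :: "'p::finite \<Rightarrow> 'w"
  shows "jacobian (logit \<theta> od) (at c) = (- \<theta>) *\<^sub>R logit_covariance od (logit \<theta> od c)"
proof -
  let ?M = "(- \<theta>) *\<^sub>R logit_covariance od (logit \<theta> od c)"
  let ?e = "\<lambda>j. exp (- \<theta> * c $ j)"
  have "((\<lambda>c. logit \<theta> od c $ i) has_derivative (\<lambda>x. (?M *v x) $ i)) (at c)" for i
  proof -
    let ?Z = "\<Sum>j | od j = od i. ?e j"
    have Z: "0 < ?Z" by (rule sum_pos2[of _ i]) auto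
    have e: "((\<lambda>c. exp (- \<theta> * c $ j)) has_derivative (\<lambda>x. ?e j * (- \<theta> * x $ j))) (at c)" for j
      by (auto intro!: derivative_eq_intros bounded_linear_imp_has_derivative bounded_linear_vec_nth)
    have "((\<lambda>c. exp (- \<theta> * c $ i) / (\<Sum>j | od j = od i. exp (- \<theta> * c $ j))) has_derivative
        (\<lambda>x. (?e i * (- \<theta> * x $ i) * ?Z - ?e i * (\<Sum>j | od j = od i. ?e j * (- \<theta> * x $ j)))
          / (?Z * ?Z))) (at c)"
      by (rule has_derivative_divide'[OF e has_derivative_sum[OF e]]) (use Z in simp)
    moreover have "(?e i * (- \<theta> * x $ i) * ?Z - ?e i * (\<Sum>j | od j = od i. ?e j * (- \<theta> * x $ j)))
          / (?Z * ?Z) = (?M *v x) $ i" for x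
    proof -
      \<comment> \<open>\<open>?T / ?Z\<close> is the mean of the direction \<open>x\<close> over
        the block under the logit probabilities, which is the term subtracted in
        \<open>logit_covariance_mult_nth\<close>.\<close>
      let ?T = "\<Sum>j | od j = od i. ?e j * x $ j"
      have s: "(\<Sum>j | od j = od i. ?e j * (- \<theta> * x $ j)) = - \<theta> * ?T"
        by (simp add: sum_distrib_left algebra_simps)
      have p: "(\<Sum>j | od j = od i. logit \<theta> od c $ j * x $ j) = ?T / ?Z"
        by (auto simp: logit_def sum_divide_distrib intro!: sum.cong)
      have "(?M *v x) $ i = - \<theta> * (logit \<theta> od c $ i * (x $ i - ?T / ?Z))"
        by (simp only: scaleR_matrix_vector_assoc[symmetric] vector_scaleR_component
            logit_covariance_mult_nth p real_scaleR_def)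
      also have "logit \<theta> od c $ i = ?e i / ?Z" by (simp add: logit_def)
      also have "- \<theta> * (?e i / ?Z * (x $ i - ?T / ?Z)) =
          (?e i * (- \<theta> * x $ i) * ?Z - ?e i * (- \<theta> * ?T)) / (?Z * ?Z)"
        using Z by (simp add: field_simps)
      finally show ?thesis unfolding s by simp
    qed
    ultimately show ?thesis unfolding logit_def by simp
  qed
  then have "(logit \<theta> od has_derivative (\<lambda>x. ?M *v x)) (at c)"
    by (subst has_derivative_componentwise_within) (auto simp: Basis_vec_def inner_axis)
  from frechet_derivative_at[OF this, symmetric] show ?thesis
    by (simp only: jacobian_def matrix_of_matrix_vector_mul)
qed

section \<open>The weighted covariance matrix\<close>

text \<open>With weights \<open>\<theta> * d w\<close> this becomes the matrix \<open>S\<close>,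
  that is, minus the product of the first two Jacobians.\<close>

definition weighted_covariance ::
    "('w \<Rightarrow> real) \<Rightarrow> ('p::finite \<Rightarrow> 'w) \<Rightarrow> real ^ 'p \<Rightarrow> real ^ 'p ^ 'p" where
  "weighted_covariance d od p =
    (\<chi> i j. if i = j then d (od i) else 0) ** logit_covariance od p"

lemma weighted_covariance_nth:
  "weighted_covariance d od p $ i $ j = d (od i) * logit_covariance od p $ i $ j"
  by (simp add: weighted_covariance_def matrix_matrix_mult_def if_distrib[of "\<lambda>x. x * _"]
      cong: if_cong)

lemma weighted_covariance_mult_nth:
  "(weighted_covariance d od p *v x) $ i =
    d (od i) * (p $ i * (x $ i - (\<Sum>j | od j = od i. p $ j * x $ j)))"
  by (simp add: logit_covariance_mult_nth[symmetric])
    (simp add: matrix_vector_mult_def weighted_covariance_nth sum_distrib_left mult.assoc)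

text \<open>Row scaling preserves symmetry here because the weight is constant on each OD block and
  entries between different blocks vanish.\<close>

lemma transpose_weighted_covariance:
  "transpose (weighted_covariance d od p) = weighted_covariance d od p"
  by (auto simp: transpose_def vec_eq_iff weighted_covariance_nth) (auto simp: logit_covariance_def)

text \<open>Constants do not deviate from their block means. This is the source of the eigenvalue
  zero.\<close>

lemma weighted_covariance_1:
  assumes "\<And>i. (\<Sum>j | od j = od i. p $ j) = 1"
  shows "weighted_covariance d od p *v 1 = 0"
  using assms by (simp add: vec_eq_iff weighted_covariance_mult_nth)

text \<open>Two expressions for a weighted sum of block variances: the centred one yields
  positivity, the second moment minus squared mean yields the upper bound.\<close>

lemma weighted_covariance_form:
  fixes od :: "'p::finite \<Rightarrow> 'w::finite"
  assumes p: "\<And>i. (\<Sum>j | od j = od i. p $ j) = 1"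
  defines "m \<equiv> \<lambda>x i. \<Sum>j | od j = od i. p $ j * x $ j"
  shows "x \<bullet> (weighted_covariance d od p *v x) = (\<Sum>i\<in>UNIV. d (od i) * p $ i * (x $ i - m x i)\<^sup>2)"
    and "x \<bullet> (weighted_covariance d od p *v x) =
      (\<Sum>i\<in>UNIV. d (od i) * p $ i * (x $ i)\<^sup>2) - (\<Sum>i\<in>UNIV. d (od i) * p $ i * (m x i)\<^sup>2)"
proof -
  \<comment> \<open>Block means are orthogonal to deviations: on one block both \<open>d\<close> and
    \<open>m x\<close> are constant and factor out, and the weighted deviations sum to zero.
    Subtracting or adding this vanishing sum gives the two formulas.\<close>
  have "(\<Sum>i\<in>UNIV. d (od i) * p $ i * m x i * (x $ i - m x i)) =
      (\<Sum>w\<in>UNIV. \<Sum>i | od i = w. d (od i) * p $ i * m x i * (x $ i - m x i))"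
    using sum.group[of UNIV UNIV od "\<lambda>i. d (od i) * p $ i * m x i * (x $ i - m x i)"] by simp
  also have "\<dots> = 0"
  proof (rule sum.neutral, rule ballI)
    fix w :: 'w
    show "(\<Sum>i | od i = w. d (od i) * p $ i * m x i * (x $ i - m x i)) = 0"
    proof (cases "\<exists>k. od k = w")
      case False
      then show ?thesis by simp
    next
      case True
      then obtain k where k: "w = od k" by auto
      have "d (od i) * p $ i * m x i * (x $ i - m x i) =
          d (od k) * m x k * (p $ i * x $ i - p $ i * m x k)" if "od i = od k" for i
        using that by (simp add: m_def right_diff_distrib mult_ac)
      then have "(\<Sum>i | od i = w. d (od i) * p $ i * m x i * (x $ i - m x i)) =
          (\<Sum>i | od i = od k. d (od k) * m x k * (p $ i * x $ i - p $ i * m x k))"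
        unfolding k by (intro sum.cong) simp_all
      also have "\<dots> = d (od k) * m x k * (m x k - (\<Sum>i | od i = od k. p $ i) * m x k)"
        by (simp only: sum_distrib_left[symmetric] sum_distrib_right[symmetric] sum_subtractf m_def)
      finally show ?thesis using p by simp
    qed
  qed
  finally have orth: "(\<Sum>i\<in>UNIV. d (od i) * p $ i * m x i * (x $ i - m x i)) = 0" .
  have form: "x \<bullet> (weighted_covariance d od p *v x) =
      (\<Sum>i\<in>UNIV. d (od i) * p $ i * x $ i * (x $ i - m x i))"
    by (simp add: inner_vec_def weighted_covariance_mult_nth m_def mult_ac)
  have "\<dots> - (\<Sum>i\<in>UNIV. d (od i) * p $ i * m x i * (x $ i - m x i)) =
      (\<Sum>i\<in>UNIV. d (od i) * p $ i * (x $ i - m x i)\<^sup>2)"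
    by (simp add: sum_subtractf[symmetric] power2_eq_square algebra_simps)
  with form orth show "x \<bullet> (weighted_covariance d od p *v x) =
      (\<Sum>i\<in>UNIV. d (od i) * p $ i * (x $ i - m x i)\<^sup>2)" by simp
  have "(\<Sum>i\<in>UNIV. d (od i) * p $ i * x $ i * (x $ i - m x i))
        + (\<Sum>i\<in>UNIV. d (od i) * p $ i * m x i * (x $ i - m x i)) =
      (\<Sum>i\<in>UNIV. d (od i) * p $ i * (x $ i)\<^sup>2) - (\<Sum>i\<in>UNIV. d (od i) * p $ i * (m x i)\<^sup>2)"
    by (simp add: sum_subtractf[symmetric] sum.distrib[symmetric] power2_eq_square algebra_simps)
  with form orth show "x \<bullet> (weighted_covariance d od p *v x) =
      (\<Sum>i\<in>UNIV. d (od i) * p $ i * (x $ i)\<^sup>2) - (\<Sum>i\<in>UNIV. d (od i) * p $ i * (m x i)\<^sup>2)"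
    by simp
qed

lemma weighted_covariance_psd:
  fixes od :: "'p::finite \<Rightarrow> 'w::finite"
  assumes "\<And>i. (\<Sum>j | od j = od i. p $ j) = 1" and "\<And>i. 0 \<le> p $ i" and "\<And>w. 0 \<le> d w"
  shows "0 \<le> x \<bullet> (weighted_covariance d od p *v x)"
  by (subst weighted_covariance_form(1)) (auto intro!: sum_nonneg assms mult_nonneg_nonneg)

text \<open>Drop the squared means from the second variance formula, then bound each coefficient by
  \<open>p \<le> 1\<close> and \<open>d \<le> B\<close>.\<close>

lemma weighted_covariance_le:
  fixes od :: "'p::finite \<Rightarrow> 'w::finite"
  assumes p1: "\<And>i. (\<Sum>j | od j = od i. p $ j) = 1" and p: "\<And>i. 0 \<le> p $ i" "\<And>i. p $ i \<le> 1"
    and d: "\<And>w. 0 \<le> d w" "\<And>w. d w \<le> B"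
  shows "x \<bullet> (weighted_covariance d od p *v x) \<le> B * (x \<bullet> x)"
proof -
  have "x \<bullet> (weighted_covariance d od p *v x) \<le> (\<Sum>i\<in>UNIV. d (od i) * p $ i * (x $ i)\<^sup>2)"
    using weighted_covariance_form(2)[OF p1, of x d]
    by (auto intro!: sum_nonneg mult_nonneg_nonneg p d)
  also have "\<dots> \<le> (\<Sum>i\<in>UNIV. B * (x $ i)\<^sup>2)"
  proof (intro sum_mono mult_right_mono)
    show "d (od i) * p $ i \<le> B" for i
      using mult_left_mono[OF p(2)[of i] d(1)[of "od i"]] d(2)[of "od i"] by simp
  qed auto
  also have "\<dots> = B * (x \<bullet> x)"
    by (simp add: inner_vec_def sum_distrib_left power2_eq_square)
  finally show ?thesis .
qed

section \<open>The cost Jacobian\<close>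

text \<open>Difference quotients of a monotone function are nonnegative on both sides, and this
  passes to the limit.\<close>

lemma link_deriv_nonneg:
  assumes mono: "mono_on {0..} f" and diff: "f differentiable_on {0..}" and x: "0 \<le> x"
  shows "0 \<le> link_deriv f x"
proof -
  have "(f has_vector_derivative link_deriv f x) (at x within {0..})"
    using diff x unfolding link_deriv_def
    by (simp add: differentiable_on_def vector_derivative_works)
  then have lim: "((\<lambda>y. (f y - f x) / (y - x)) \<longlongrightarrow> link_deriv f x) (at x within {0..})"
    by (simp add: has_real_derivative_iff_has_vector_derivative[symmetric] has_field_derivative_iff)
  have "0 \<le> (f y - f x) / (y - x)" if "y \<in> {0..}" for y
    using mono_onD[OF mono, of x y] mono_onD[OF mono, of y x] that x
    by (cases "x \<le> y") (auto simp: divide_nonpos_nonpos)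
  then have "\<forall>\<^sub>F y in at x within {0..}. 0 \<le> (f y - f x) / (y - x)"
    by (simp add: eventually_at_filter)
  \<comment> \<open>Approaching from the right keeps the witness in the half-line even at the
    endpoint \<open>x = 0\<close>.\<close>
  moreover have "at x within {0..} \<noteq> bot"
  proof -
    have "\<exists>y\<in>{0..}. y \<noteq> x \<and> dist y x < e" if "0 < e" for e
      using that x by (intro bexI[of _ "x + e / 2"]) (auto simp: dist_real_def)
    then show ?thesis by (simp add: trivial_limit_within islimpt_approachable)
  qed
  ultimately show ?thesis by (intro tendsto_lowerbound[OF lim])
qed

text \<open>The quadratic form of \<open>J\<close> at \<open>x\<close> is the sum of the squares of
  the entries of \<open>D *v x\<close>, weighted by \<open>t\<close>.\<close>

lemma transpose_congruence_diagonal: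
  fixes D :: "real ^ 'p ^ 'l" and t :: "'l \<Rightarrow> real"
  defines "J \<equiv> transpose D ** (\<chi> l m. if l = m then t l else 0) ** D"
  shows "transpose J = J"
    and "(\<And>l. 0 \<le> t l) \<Longrightarrow> 0 \<le> x \<bullet> (J *v x)"
proof -
  let ?T = "(\<chi> l m. if l = m then t l else 0) :: real ^ 'l ^ 'l"
  have "transpose ?T = ?T" by (simp add: transpose_def vec_eq_iff)
  then show "transpose J = J"
    by (simp add: J_def matrix_transpose_mul matrix_mul_assoc)
  have "J *v x = transpose D *v (?T *v (D *v x))"
    by (simp only: J_def matrix_vector_mul_assoc[symmetric])
  then have "x \<bullet> (J *v x) = (D *v x) \<bullet> (?T *v (D *v x))"
    by (simp only: transpose_matrix_vector inner_commute[of x] dot_lmul_matrix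
        inner_commute[of _ "D *v x"])
  also have "\<dots> = (\<Sum>l\<in>UNIV. t l * ((D *v x) $ l)\<^sup>2)"
  proof -
    have "(?T *v y) $ l = t l * y $ l" for y l
      by (simp add: matrix_vector_mult_def if_distrib[of "\<lambda>x. x * _"] cong: if_cong)
    then show ?thesis by (simp add: inner_vec_def power2_eq_square mult_ac)
  qed
  finally show "0 \<le> x \<bullet> (J *v x)" if "\<And>l. 0 \<le> t l"
    using that by (simp add: sum_nonneg)
qed

section \<open>Positivity of the cost Jacobian and factorisation of the reduced Jacobian\<close>

context logit_network
begin

lemma path_cost_jacobian_psd:
  assumes h: "feasible od d h"
  defines "J \<equiv> path_cost_jacobian links_of \<tau> h"
  shows "transpose J = J" "0 \<le> x \<bullet> (J *v x)"
proof -
  have h0: "0 \<le> h $ i" for i using h by (simp add: feasible_def)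
  note J = J_def path_cost_jacobian_eq[OF h0]
  have "0 \<le> (incidence links_of *v h) $ l" for l
    by (auto simp: matrix_vector_mult_def incidence_def h0 intro!: sum_nonneg)
  then have "0 \<le> link_deriv (\<tau> l) ((incidence links_of *v h) $ l)" for l
    by (intro link_deriv_nonneg cost_mono cost_differentiable)
  then show "transpose J = J" "0 \<le> x \<bullet> (J *v x)"
    unfolding J by (auto intro!: transpose_congruence_diagonal)
qed

lemma reduced_jacobian_eq:
  assumes h: "feasible od d h"
  defines "p \<equiv> logit \<theta> od (path_cost links_of \<tau> h)"
  shows "reduced_jacobian \<theta> od links_of \<tau> h =
    - (weighted_covariance (\<lambda>w. \<theta> * d w) od p ** path_cost_jacobian links_of \<tau> h)"
proof -
  have "jacobian (assigned_flow od h) (at p) ** ((- \<theta>) *\<^sub>R logit_covariance od p) =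
      - weighted_covariance (\<lambda>w. \<theta> * d w) od p"
    by (simp add: assigned_flow_jacobian_eq[OF h] vec_eq_iff weighted_covariance_nth
        matrix_matrix_mult_def if_distrib[of "\<lambda>x. x * _"] if_distrib[of uminus] cong: if_cong)
  then show ?thesis
    by (simp add: reduced_jacobian_def Let_def logit_jacobian_eq p_def[symmetric])
      (simp add: matrix_matrix_mult_def vec_eq_iff sum_negf)
qed

end

theorem theorem1:
  fixes G :: "('v, 'l::finite) pre_digraph"
    and od_pair :: "'w::finite \<Rightarrow> 'v \<times> 'v"
    and d :: "'w \<Rightarrow> real"
    and od :: "'p::finite \<Rightarrow> 'w"
    and links_of :: "'p \<Rightarrow> 'l list"
    and \<tau> :: "'l \<Rightarrow> real \<Rightarrow> real"
    and \<theta> :: real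
    and h :: "real ^ 'p"
  assumes "logit_network G od_pair d od links_of \<tau> \<theta>"
    and "feasible od d h"
  shows "(\<forall>z \<in> eigenvalues (reduced_jacobian \<theta> od links_of \<tau> h). z \<in> \<real> \<and> Re z \<le> 0)
    \<and> real_eigenvalues (reduced_jacobian \<theta> od links_of \<tau> h) \<noteq> {}
    \<and> Max (real_eigenvalues (reduced_jacobian \<theta> od links_of \<tau> h)) = 0
    \<and> Min (real_eigenvalues (reduced_jacobian \<theta> od links_of \<tau> h))
        \<ge> - \<theta> * (MAX w. d w) * onorm (\<lambda>x. path_cost_jacobian links_of \<tau> h *v x)"
proof -
  interpret logit_network G od_pair d od links_of \<tau> \<theta> by (rule assms(1))
  define p where "p = logit \<theta> od (path_cost links_of \<tau> h)"
  let ?K = "reduced_jacobian \<theta> od links_of \<tau> h"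
  let ?J = "path_cost_jacobian links_of \<tau> h"
  let ?S = "weighted_covariance (\<lambda>w. \<theta> * d w) od p"
  let ?b = "- \<theta> * (MAX w. d w) * onorm (\<lambda>x. ?J *v x)"
  have p: "(\<Sum>j | od j = od i. p $ j) = 1" "0 \<le> p $ i" "p $ i \<le> 1" for i
    by (simp_all add: p_def sum_logit logit_nonneg logit_le_1)
  have K: "?K = - (?S ** ?J)" using reduced_jacobian_eq[OF assms(2)] by (simp add: p_def)
  have dw: "0 \<le> \<theta> * d w" "\<theta> * d w \<le> \<theta> * (MAX w. d w)" for w
    using theta_pos demand_nonneg[of w] by (auto intro!: mult_left_mono)
  \<comment> \<open>The OD type is inhabited, so any single demand gives a nonnegative lower bound
    for the maximum.\<close>
  have s: "0 \<le> \<theta> * (MAX w. d w)" using dw order_trans by blast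
  have ev: "z \<in> \<real>" "Re z \<le> 0" "?b \<le> Re z" if "z \<in> eigenvalues ?K" for z
  proof -
    note * = eigenvalues_neg_psd_product[OF transpose_weighted_covariance
        weighted_covariance_psd[OF p(1,2) dw(1)] weighted_covariance_le[OF p dw] s
        path_cost_jacobian_psd[OF assms(2)] that[unfolded K]]
    show "z \<in> \<real>" "Re z \<le> 0" "?b \<le> Re z" using * by simp_all
  qed
  \<comment> \<open>Transposing moves the symmetric factor \<open>?S\<close> next to the constant
    vector, which it annihilates.\<close>
  have "transpose ?K *v 1 = 0"
  proof -
    have "transpose (?S ** ?J) *v 1 = transpose ?J *v (?S *v 1)"
      by (simp only: matrix_transpose_mul transpose_weighted_covariance matrix_vector_mul_assoc)
    also have "\<dots> = 0" by (simp add: weighted_covariance_1[OF p(1)])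
    finally show ?thesis
      unfolding K by (simp add: vec_eq_iff transpose_def matrix_vector_mult_def sum_negf)
  qed
  then have zero: "0 \<in> real_eigenvalues ?K"
    by (intro zero_in_real_eigenvalues[of 1]) auto
  \<comment> \<open>All real eigenvalues lie between \<open>?b\<close> and 0, and 0 is attained;
    finiteness of the set then settles \<open>Max\<close> and \<open>Min\<close>.\<close>
  have "x \<le> 0" "?b \<le> x" if "x \<in> real_eigenvalues ?K" for x
    using ev[of "complex_of_real x"] that by (simp_all add: real_eigenvalues_def)
  with zero ev show ?thesis
    by (auto simp: finite_real_eigenvalues intro!: Max_eqI Min.boundedI)
qed

end
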